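(* The category $\mathbf{HI\text{-}TopSys}$ is dually equivalent to the category $\mathbf{HA}$; that is, $\mathbf{HI\text{-}TopSys}$ is equivalent to $\mathbf{HA}^{op}$.
   Context: A Heyting algebra is an algebra $(A,\vee,\wedge,\rightarrow,\mathbf{1},\mathbf{0})$ such that $(A,\vee,\wedge,\mathbf{1},\mathbf{0})$ is a bounded distributive lattice and $\rightarrow$ is a binary operation adjoint to $\wedge$ ($c\wedge a\le b$ iff $c\le a\rightarrow b$). A Heyting homomorphism is a map preserving $\wedge,\vee,\rightarrow,\mathbf{0}$. $\mathbf{HA}$ is the category of Heyting algebras and Heyting homomorphisms. $Hom(A,\{0,1\})$ denotes the set of all bounded distributive lattice homomorphisms from $A$ to the two-element algebra $\{0,1\}$, ordered pointwise: $h_1Rh_2$ iff $h_1(a)\le h_2(a)$ for all $a\in A$. An I-topological system is a triple $(X,\models,A)$ consisting of a nonempty set $X$, a Heyting algebra $A$ and a relation $\models$ from $X$ to $A$ such that: (1) $x\models\mathbf{0}$ for no $x\in X$; (2) $x\models a\wedge b$ iff $x\models a$ and $x\models b$; (3) $x\models a\vee b$ iff $x\models a$ or $x\models b$; (4) $x\models a\rightarrow b$ iff for all $y\in X$ such that $p^*(x)Rp^*(y)$, $y\not\models a$ or $y\models b$, where $p^*:X\to Hom(A,\{0,1\})$ is given by $p^*(x)(a)=1$ iff $x\models a$. It is Heyting algebraic if $p^*$ is a bijection. $\mathbf{HI\text{-}TopSys}$ is the category whose objects are Heyting algebraic I-topological systems and whose morphisms $(X,\models,A)\to(Y,\models',B)$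 are pairs $(f_1,f_2)$ with $f_1:X\to Y$ a map of sets, $f_2:B\to A$ a Heyting homomorphism, and $x\models f_2(b)$ iff $f_1(x)\models' b$ for all $x\in X$, $b\in B$. Identities are $(id_X,id_A)$ and composition is $(g_1,g_2)\circ(f_1,f_2)=(g_1\circ f_1,f_2\circ g_2)$.
   Formalization: As stated false: the one-element Heyting algebra has no point. Proved instead: HI-TopSys (X nonempty) is dual to Heyting algebras with 0≠1, and HI-TopSys with X possibly empty is dual to HA; algebras range over subsets of an arbitrary set, points over a set large enough to hold its powerset. *)

theory Defs
  imports "HOL-Algebra.Congruence" "HOL-Library.FuncSet"
begin

section \<open>Categories, functors, equivalence\<close>

text \<open>
  Arrows need not determine their source and target (in the examples below they are extensional
  functions), so composition and the action of a functor on arrows take the objects involved as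
  arguments: \<open>Comp C X Y Z g f\<close> is $g \circ f$ for $f : X \to Y$ and $g : Y \to Z$.
\<close>

record ('o, 'm) category =
  Obj :: "'o set"
  Hom :: "'o \<Rightarrow> 'o \<Rightarrow> 'm set"
  Ident :: "'o \<Rightarrow> 'm"
  Comp :: "'o \<Rightarrow> 'o \<Rightarrow> 'o \<Rightarrow> 'm \<Rightarrow> 'm \<Rightarrow> 'm"

locale category =
  fixes C :: "('o, 'm) category"
  assumes Ident_in_Hom: "X \<in> Obj C \<Longrightarrow> Ident C X \<in> Hom C X X"
    and Comp_in_Hom:
      "\<lbrakk>X \<in> Obj C; Y \<in> Obj C; Z \<in> Obj C; f \<in> Hom C X Y; g \<in> Hom C Y Z\<rbrakk>
        \<Longrightarrow> Comp C X Y Z g f \<in> Hom C X Z"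
    and Comp_Ident_right:
      "\<lbrakk>X \<in> Obj C; Y \<in> Obj C; f \<in> Hom C X Y\<rbrakk> \<Longrightarrow> Comp C X X Y f (Ident C X) = f"
    and Comp_Ident_left:
      "\<lbrakk>X \<in> Obj C; Y \<in> Obj C; f \<in> Hom C X Y\<rbrakk> \<Longrightarrow> Comp C X Y Y (Ident C Y) f = f"
    and Comp_assoc:
      "\<lbrakk>W \<in> Obj C; X \<in> Obj C; Y \<in> Obj C; Z \<in> Obj C;
        f \<in> Hom C W X; g \<in> Hom C X Y; h \<in> Hom C Y Z\<rbrakk>
        \<Longrightarrow> Comp C W Y Z h (Comp C W X Y g f) = Comp C W X Z (Comp C X Y Z h g) f"

definition op_category :: "('o, 'm) category \<Rightarrow> ('o, 'm) category" where
  "op_category C =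
    \<lparr>Obj = Obj C, Hom = (\<lambda>X Y. Hom C Y X), Ident = Ident C,
     Comp = (\<lambda>X Y Z g f. Comp C Z Y X f g)\<rparr>"

definition is_iso :: "('o, 'm) category \<Rightarrow> 'o \<Rightarrow> 'o \<Rightarrow> 'm \<Rightarrow> bool" where
  "is_iso C X Y f \<longleftrightarrow> f \<in> Hom C X Y \<and>
    (\<exists>g \<in> Hom C Y X. Comp C X Y X g f = Ident C X \<and> Comp C Y X Y f g = Ident C Y)"

record ('o1, 'm1, 'o2, 'm2) functor_data =
  on_obj :: "'o1 \<Rightarrow> 'o2"
  on_arr :: "'o1 \<Rightarrow> 'o1 \<Rightarrow> 'm1 \<Rightarrow> 'm2"

locale is_functor =
  fixes C :: "('o1, 'm1) category" and D :: "('o2, 'm2) category"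
    and F :: "('o1, 'm1, 'o2, 'm2) functor_data"
  assumes on_obj_in_Obj: "X \<in> Obj C \<Longrightarrow> on_obj F X \<in> Obj D"
    and on_arr_in_Hom:
      "\<lbrakk>X \<in> Obj C; Y \<in> Obj C; f \<in> Hom C X Y\<rbrakk>
        \<Longrightarrow> on_arr F X Y f \<in> Hom D (on_obj F X) (on_obj F Y)"
    and on_arr_Ident: "X \<in> Obj C \<Longrightarrow> on_arr F X X (Ident C X) = Ident D (on_obj F X)"
    and on_arr_Comp:
      "\<lbrakk>X \<in> Obj C; Y \<in> Obj C; Z \<in> Obj C; f \<in> Hom C X Y; g \<in> Hom C Y Z\<rbrakk>
        \<Longrightarrow> on_arr F X Z (Comp C X Y Z g f) =
            Comp D (on_obj F X) (on_obj F Y) (on_obj F Z) (on_arr F Y Z g) (on_arr F X Y f)"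

definition id_functor :: "('o, 'm, 'o, 'm) functor_data" where
  "id_functor = \<lparr>on_obj = (\<lambda>X. X), on_arr = (\<lambda>X Y f. f)\<rparr>"

definition comp_functor ::
  "('o2, 'm2, 'o3, 'm3) functor_data \<Rightarrow> ('o1, 'm1, 'o2, 'm2) functor_data
    \<Rightarrow> ('o1, 'm1, 'o3, 'm3) functor_data" where
  "comp_functor G F =
    \<lparr>on_obj = (\<lambda>X. on_obj G (on_obj F X)),
     on_arr = (\<lambda>X Y f. on_arr G (on_obj F X) (on_obj F Y) (on_arr F X Y f))\<rparr>"

definition natural_iso ::
  "('o1, 'm1) category \<Rightarrow> ('o2, 'm2) category \<Rightarrow> ('o1, 'm1, 'o2, 'm2) functor_data
    \<Rightarrow> ('o1, 'm1, 'o2, 'm2) functor_data \<Rightarrow> ('o1 \<Rightarrow> 'm2) \<Rightarrow> bool" where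
  "natural_iso C D F G \<eta> \<longleftrightarrow>
    (\<forall>X \<in> Obj C. is_iso D (on_obj F X) (on_obj G X) (\<eta> X)) \<and>
    (\<forall>X \<in> Obj C. \<forall>Y \<in> Obj C. \<forall>f \<in> Hom C X Y.
      Comp D (on_obj F X) (on_obj F Y) (on_obj G Y) (\<eta> Y) (on_arr F X Y f) =
      Comp D (on_obj F X) (on_obj G X) (on_obj G Y) (on_arr G X Y f) (\<eta> X))"

definition equivalent_categories :: "('o1, 'm1) category \<Rightarrow> ('o2, 'm2) category \<Rightarrow> bool" where
  "equivalent_categories C D \<longleftrightarrow> category C \<and> category D \<and>
    (\<exists>F G. is_functor C D F \<and> is_functor D C G \<and>
      (\<exists>\<eta>. natural_iso C C id_functor (comp_functor G F) \<eta>) \<and>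
      (\<exists>\<epsilon>. natural_iso D D (comp_functor F G) id_functor \<epsilon>))"

definition dually_equivalent :: "('o1, 'm1) category \<Rightarrow> ('o2, 'm2) category \<Rightarrow> bool" where
  "dually_equivalent C D \<longleftrightarrow> equivalent_categories C (op_category D)"


section \<open>Heyting algebras\<close>

record 'a heyting = "'a partial_object" +
  Join :: "'a \<Rightarrow> 'a \<Rightarrow> 'a"
  Meet :: "'a \<Rightarrow> 'a \<Rightarrow> 'a"
  Imp :: "'a \<Rightarrow> 'a \<Rightarrow> 'a"
  One :: 'a
  Zero :: 'a

definition Le :: "'a heyting \<Rightarrow> 'a \<Rightarrow> 'a \<Rightarrow> bool" where
  "Le A a b \<longleftrightarrow> Meet A a b = a"

locale heyting_algebra =
  fixes A :: "'a heyting"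
  assumes Join_closed: "\<lbrakk>a \<in> carrier A; b \<in> carrier A\<rbrakk> \<Longrightarrow> Join A a b \<in> carrier A"
    and Meet_closed: "\<lbrakk>a \<in> carrier A; b \<in> carrier A\<rbrakk> \<Longrightarrow> Meet A a b \<in> carrier A"
    and Imp_closed: "\<lbrakk>a \<in> carrier A; b \<in> carrier A\<rbrakk> \<Longrightarrow> Imp A a b \<in> carrier A"
    and One_closed: "One A \<in> carrier A"
    and Zero_closed: "Zero A \<in> carrier A"
    and Join_commute: "\<lbrakk>a \<in> carrier A; b \<in> carrier A\<rbrakk> \<Longrightarrow> Join A a b = Join A b a"
    and Meet_commute: "\<lbrakk>a \<in> carrier A; b \<in> carrier A\<rbrakk> \<Longrightarrow> Meet A a b = Meet A b a"
    and Join_assoc: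
      "\<lbrakk>a \<in> carrier A; b \<in> carrier A; c \<in> carrier A\<rbrakk>
        \<Longrightarrow> Join A (Join A a b) c = Join A a (Join A b c)"
    and Meet_assoc:
      "\<lbrakk>a \<in> carrier A; b \<in> carrier A; c \<in> carrier A\<rbrakk>
        \<Longrightarrow> Meet A (Meet A a b) c = Meet A a (Meet A b c)"
    and Join_absorb: "\<lbrakk>a \<in> carrier A; b \<in> carrier A\<rbrakk> \<Longrightarrow> Join A a (Meet A a b) = a"
    and Meet_absorb: "\<lbrakk>a \<in> carrier A; b \<in> carrier A\<rbrakk> \<Longrightarrow> Meet A a (Join A a b) = a"
    and Meet_Join_distrib:
      "\<lbrakk>a \<in> carrier A; b \<in> carrier A; c \<in> carrier A\<rbrakk>
        \<Longrightarrow> Meet A a (Join A b c) = Join A (Meet A a b) (Meet A a c)"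
    and Le_One: "a \<in> carrier A \<Longrightarrow> Le A a (One A)"
    and Zero_Le: "a \<in> carrier A \<Longrightarrow> Le A (Zero A) a"
    and Imp_adjoint:
      "\<lbrakk>a \<in> carrier A; b \<in> carrier A; c \<in> carrier A\<rbrakk>
        \<Longrightarrow> Le A (Meet A c a) b \<longleftrightarrow> Le A c (Imp A a b)"

text \<open>Maps between carriers are extensional (\<open>\<rightarrow>\<^sub>E\<close>), so that equality of arrows is equality
  on the carrier.\<close>

definition heyting_hom :: "'a heyting \<Rightarrow> 'b heyting \<Rightarrow> ('a \<Rightarrow> 'b) set" where
  "heyting_hom A B = {f \<in> carrier A \<rightarrow>\<^sub>E carrier B.
    (\<forall>a \<in> carrier A. \<forall>b \<in> carrier A.
      f (Meet A a b) = Meet B (f a) (f b) \<and>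
      f (Join A a b) = Join B (f a) (f b) \<and>
      f (Imp A a b) = Imp B (f a) (f b)) \<and>
    f (Zero A) = Zero B}"

definition HA :: "('a heyting, 'a \<Rightarrow> 'a) category" where
  "HA =
    \<lparr>Obj = {A. heyting_algebra A},
     Hom = heyting_hom,
     Ident = (\<lambda>A. \<lambda>a \<in> carrier A. a),
     Comp = (\<lambda>A B C g f. compose (carrier A) g f)\<rparr>"

definition HA_nontrivial :: "('a heyting, 'a \<Rightarrow> 'a) category" where
  "HA_nontrivial = HA\<lparr>Obj := {A. heyting_algebra A \<and> Zero A \<noteq> One A}\<rparr>"

definition bounded_lattice_hom :: "'a heyting \<Rightarrow> 'b heyting \<Rightarrow> ('a \<Rightarrow> 'b) set" where
  "bounded_lattice_hom A B = {h \<in> carrier A \<rightarrow>\<^sub>E carrier B.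
    (\<forall>a \<in> carrier A. \<forall>b \<in> carrier A.
      h (Meet A a b) = Meet B (h a) (h b) \<and>
      h (Join A a b) = Join B (h a) (h b)) \<and>
    h (One A) = One B \<and> h (Zero A) = Zero B}"

definition two :: "bool heyting" where
  "two = \<lparr>carrier = UNIV, Join = (\<or>), Meet = (\<and>), Imp = (\<longrightarrow>), One = True, Zero = False\<rparr>"

definition hom_le :: "'a heyting \<Rightarrow> ('a \<Rightarrow> bool) \<Rightarrow> ('a \<Rightarrow> bool) \<Rightarrow> bool" where
  "hom_le A h\<^sub>1 h\<^sub>2 \<longleftrightarrow> (\<forall>a \<in> carrier A. Le two (h\<^sub>1 a) (h\<^sub>2 a))"


section \<open>I-topological systems\<close>

record ('x, 'a) top_system =
  points :: "'x set"
  sat :: "'x \<Rightarrow> 'a \<Rightarrow> bool"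
  algebra :: "'a heyting"

definition pstar :: "('x, 'a) top_system \<Rightarrow> 'x \<Rightarrow> 'a \<Rightarrow> bool" where
  "pstar S x = (\<lambda>a \<in> carrier (algebra S). sat S x a)"

text \<open>The point set is allowed to be empty here; \<open>i_topological_system\<close> below excludes this.\<close>

locale i_topological_system_or_empty =
  fixes S :: "('x, 'a) top_system"
  assumes heyting_algebra_algebra: "heyting_algebra (algebra S)"
    and sat_dom: "sat S x a \<Longrightarrow> x \<in> points S \<and> a \<in> carrier (algebra S)"
    and sat_Zero: "x \<in> points S \<Longrightarrow> \<not> sat S x (Zero (algebra S))"
    and sat_Meet:
      "\<lbrakk>x \<in> points S; a \<in> carrier (algebra S); b \<in> carrier (algebra S)\<rbrakk>
        \<Longrightarrow> sat S x (Meet (algebra S) a b) \<longleftrightarrow> sat S x a \<and> sat S x b"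
    and sat_Join:
      "\<lbrakk>x \<in> points S; a \<in> carrier (algebra S); b \<in> carrier (algebra S)\<rbrakk>
        \<Longrightarrow> sat S x (Join (algebra S) a b) \<longleftrightarrow> sat S x a \<or> sat S x b"
    and sat_Imp:
      "\<lbrakk>x \<in> points S; a \<in> carrier (algebra S); b \<in> carrier (algebra S)\<rbrakk>
        \<Longrightarrow> sat S x (Imp (algebra S) a b) \<longleftrightarrow>
          (\<forall>y \<in> points S. hom_le (algebra S) (pstar S x) (pstar S y) \<longrightarrow>
            \<not> sat S y a \<or> sat S y b)"

locale i_topological_system = i_topological_system_or_empty S
  for S :: "('x, 'a) top_system" +
  assumes points_nonempty: "points S \<noteq> {}"

definition heyting_algebraic :: "('x, 'a) top_system \<Rightarrow> bool" where
  "heyting_algebraic S \<longleftrightarrow>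
    bij_betw (pstar S) (points S) (bounded_lattice_hom (algebra S) two)"

definition top_system_hom ::
  "('x, 'a) top_system \<Rightarrow> ('x, 'a) top_system \<Rightarrow> (('x \<Rightarrow> 'x) \<times> ('a \<Rightarrow> 'a)) set" where
  "top_system_hom S T = {(f\<^sub>1, f\<^sub>2).
    f\<^sub>1 \<in> points S \<rightarrow>\<^sub>E points T \<and>
    f\<^sub>2 \<in> heyting_hom (algebra T) (algebra S) \<and>
    (\<forall>x \<in> points S. \<forall>b \<in> carrier (algebra T). sat S x (f\<^sub>2 b) \<longleftrightarrow> sat T (f\<^sub>1 x) b)}"

definition HI_TopSys :: "(('x, 'a) top_system, ('x \<Rightarrow> 'x) \<times> ('a \<Rightarrow> 'a)) category" where
  "HI_TopSys =
    \<lparr>Obj = {S. i_topological_system S \<and> heyting_algebraic S},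
     Hom = top_system_hom,
     Ident = (\<lambda>S. (\<lambda>x \<in> points S. x, \<lambda>a \<in> carrier (algebra S). a)),
     Comp = (\<lambda>S T U (g\<^sub>1, g\<^sub>2) (f\<^sub>1, f\<^sub>2).
       (compose (points S) g\<^sub>1 f\<^sub>1, compose (carrier (algebra U)) f\<^sub>2 g\<^sub>2))\<rparr>"

definition HI_TopSys_or_empty ::
  "(('x, 'a) top_system, ('x \<Rightarrow> 'x) \<times> ('a \<Rightarrow> 'a)) category" where
  "HI_TopSys_or_empty =
    HI_TopSys\<lparr>Obj := {S. i_topological_system_or_empty S \<and> heyting_algebraic S}\<rparr>"

text \<open>
  The one-element Heyting algebra is an object of \<open>HA\<close>, but it has no homomorphism to \<open>two\<close>, so no
  Heyting algebraic system with a nonempty point set has it as its algebra. Hence \<open>HI_TopSys\<close> is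
  dual to \<open>HA_nontrivial\<close> and not to \<open>HA\<close>, whose dual is \<open>HI_TopSys_or_empty\<close>.

  The points of a Heyting algebraic system over \<open>A\<close> are as many as the homomorphisms from \<open>A\<close> to
  \<open>two\<close>. A duality for all Heyting algebras with elements of type \<open>'a\<close> therefore needs a type of
  points \<open>'x\<close> into which \<open>'a \<Rightarrow> bool\<close> embeds; this stands in for a universe closed under powersets.
\<close>

end

theory Submission
  imports Defs
begin

text \<open>
  The functor \<open>(X, \<Turnstile>, A) \<mapsto> A\<close> is full and faithful on Heyting algebraic systems, because there
  the point component of an arrow is determined by its algebra component: the image of \<open>x\<close> is the
  unique point representing the lattice homomorphism \<open>p\<^sup>* x \<circ> f\<^sub>2\<close>. A strict section on objects
  equips a Heyting algebra with its homomorphisms to \<open>two\<close> as points. That this is a system needs,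
  for the implication, the prime filter theorem.
\<close>

section \<open>Categories\<close>

lemma category_op_category:
  assumes "category C"
  shows "category (op_category C)"
proof -
  interpret category C by fact
  show ?thesis
    by unfold_locales
      (auto simp: op_category_def Ident_in_Hom Comp_in_Hom Comp_Ident_left Comp_Ident_right Comp_assoc)
qed

text \<open>Full faithfulness lets every arrow of \<open>D\<close> between objects in the image of
  \<open>F\<close> be lifted uniquely to \<open>C\<close>. Lifting turns \<open>g\<close> into a
  functor, and every equation between arrows of \<open>C\<close> is verified in \<open>D\<close>
  after applying \<open>F\<close>. The section is strict, so the composite on \<open>D\<close> is
  the identity on objects and no transport along isomorphisms arises.\<close>

lemma equivalent_categories_if_fully_faithful_section:
  assumes "category C" and "category D" and "is_functor C D F"
    and bij: "\<And>X Y. \<lbrakk>X \<in> Obj C; Y \<in> Obj C\<rbrakk>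
      \<Longrightarrow> bij_betw (on_arr F X Y) (Hom C X Y) (Hom D (on_obj F X) (on_obj F Y))"
    and g_Obj: "\<And>A. A \<in> Obj D \<Longrightarrow> g A \<in> Obj C"
    and F_g: "\<And>A. A \<in> Obj D \<Longrightarrow> on_obj F (g A) = A"
  shows "equivalent_categories C D"
proof -
  interpret C: category C by fact
  interpret D: category D by fact
  interpret F: is_functor C D F by fact
  define L where "L X Y = inv_into (Hom C X Y) (on_arr F X Y)" for X Y
  have L_Hom: "L X Y k \<in> Hom C X Y" and F_L: "on_arr F X Y (L X Y k) = k"
    if "X \<in> Obj C" "Y \<in> Obj C" "k \<in> Hom D (on_obj F X) (on_obj F Y)" for X Y k
    using bij[OF that(1,2)] that(3) unfolding L_def
    by (metis bij_betw_def inv_into_into, metis bij_betw_inv_into_right)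
  have eqI: "f = f'"
    if "X \<in> Obj C" "Y \<in> Obj C" "f \<in> Hom C X Y" "f' \<in> Hom C X Y"
      "on_arr F X Y f = on_arr F X Y f'" for X Y f f'
    using bij[OF that(1,2)] that(3-5) by (metis bij_betw_def inj_onD)
  define G where "G = \<lparr>on_obj = g, on_arr = (\<lambda>A B. L (g A) (g B))\<rparr>"
  have G: "is_functor D C G"
  proof
    fix A assume A: "A \<in> Obj D"
    show "on_obj G A \<in> Obj C"
      by (simp add: G_def g_Obj A)
    show "on_arr G A A (Ident D A) = Ident C (on_obj G A)"
      by (rule eqI[of "g A" "g A"])
        (simp_all add: G_def A g_Obj F_g L_Hom F_L D.Ident_in_Hom C.Ident_in_Hom F.on_arr_Ident)
  next
    fix A B k assume "A \<in> Obj D" "B \<in> Obj D" "k \<in> Hom D A B"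
    then show "on_arr G A B k \<in> Hom C (on_obj G A) (on_obj G B)"
      by (simp add: G_def L_Hom g_Obj F_g)
  next
    fix A B E k l
    assume "A \<in> Obj D" "B \<in> Obj D" "E \<in> Obj D" "k \<in> Hom D A B" "l \<in> Hom D B E"
    note facts = this g_Obj F_g L_Hom F_L D.Comp_in_Hom[of A B E] C.Comp_in_Hom[of "g A" "g B" "g E"]
      F.on_arr_Comp[of "g A" "g B" "g E"]
    show "on_arr G A E (Comp D A B E l k) =
      Comp C (on_obj G A) (on_obj G B) (on_obj G E) (on_arr G B E l) (on_arr G A B k)"
      by (rule eqI[of "g A" "g E"]) (simp_all add: G_def facts)
  qed
  \<comment> \<open>The identity of \<open>on_obj F X\<close> is also an arrow from
    \<open>on_obj F X\<close> to \<open>on_obj F (g (on_obj F X))\<close>, as these objects are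
    equal; hence it can be lifted.\<close>
  define \<eta> where "\<eta> X = L X (g (on_obj F X)) (Ident D (on_obj F X))" for X
  have natural_\<eta>: "natural_iso C C id_functor (comp_functor G F) \<eta>"
    unfolding natural_iso_def
  proof (intro conjI ballI)
    fix X assume X: "X \<in> Obj C"
    \<comment> \<open>The same identity lifted in the other direction. Both composites with
      \<open>\<eta> X\<close> are sent by \<open>F\<close> to an identity, so by faithfulness they
      are identities.\<close>
    let ?\<theta> = "L (g (on_obj F X)) X (Ident D (on_obj F X))"
    note facts = X g_Obj F_g F.on_obj_in_Obj L_Hom F_L D.Ident_in_Hom C.Ident_in_Hom C.Comp_in_Hom
      F.on_arr_Ident F.on_arr_Comp D.Comp_Ident_left D.Comp_Ident_right
    have "Comp C X (g (on_obj F X)) X ?\<theta> (\<eta> X) = Ident C X"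
      by (rule eqI[of X X]) (simp_all add: \<eta>_def facts)
    moreover have "Comp C (g (on_obj F X)) X (g (on_obj F X)) (\<eta> X) ?\<theta> = Ident C (g (on_obj F X))"
      by (rule eqI[of "g (on_obj F X)" "g (on_obj F X)"]) (simp_all add: \<eta>_def facts)
    moreover have "\<eta> X \<in> Hom C X (g (on_obj F X))" "?\<theta> \<in> Hom C (g (on_obj F X)) X"
      by (simp_all add: \<eta>_def facts)
    ultimately show "is_iso C (on_obj id_functor X) (on_obj (comp_functor G F) X) (\<eta> X)"
      unfolding is_iso_def id_functor_def comp_functor_def G_def by auto
  next
    fix X Y f assume X: "X \<in> Obj C" and Y: "Y \<in> Obj C" and f: "f \<in> Hom C X Y"
    note facts = X Y f g_Obj F_g F.on_obj_in_Obj L_Hom F_L D.Ident_in_Hom C.Comp_in_Hom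
      F.on_arr_in_Hom F.on_arr_Comp D.Comp_Ident_left D.Comp_Ident_right
    have "Comp C X Y (g (on_obj F Y)) (\<eta> Y) f =
      Comp C X (g (on_obj F X)) (g (on_obj F Y))
        (L (g (on_obj F X)) (g (on_obj F Y)) (on_arr F X Y f)) (\<eta> X)"
      by (rule eqI[of X "g (on_obj F Y)"]) (simp_all add: \<eta>_def facts)
    then show "Comp C (on_obj id_functor X) (on_obj id_functor Y) (on_obj (comp_functor G F) Y)
        (\<eta> Y) (on_arr id_functor X Y f) =
      Comp C (on_obj id_functor X) (on_obj (comp_functor G F) X) (on_obj (comp_functor G F) Y)
        (on_arr (comp_functor G F) X Y f) (\<eta> X)"
      by (simp add: id_functor_def comp_functor_def G_def)
  qed
  \<comment> \<open>On \<open>D\<close> the composite functor fixes objects by \<open>F_g\<close>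
    and arrows by \<open>F_L\<close>, so identities serve as components.\<close>
  have natural_\<epsilon>: "natural_iso D D (comp_functor F G) id_functor (Ident D)"
    unfolding natural_iso_def is_iso_def comp_functor_def id_functor_def G_def
    by (auto simp: F_g g_Obj F_L D.Ident_in_Hom D.Comp_Ident_left D.Comp_Ident_right)
  show ?thesis
    unfolding equivalent_categories_def
    using \<open>category C\<close> \<open>category D\<close> \<open>is_functor C D F\<close> G natural_\<eta> natural_\<epsilon> by blast
qed

section \<open>Prime filters\<close>

context heyting_algebra
begin

section \<open>Order and residuation in a Heyting algebra\<close>

lemma Meet_idem: "a \<in> carrier A \<Longrightarrow> Meet A a a = a"
  by (metis Join_absorb Meet_absorb Meet_closed)

lemma Le_refl: "a \<in> carrier A \<Longrightarrow> Le A a a"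
  by (simp add: Le_def Meet_idem)

lemma Le_trans:
  "\<lbrakk>a \<in> carrier A; b \<in> carrier A; c \<in> carrier A; Le A a b; Le A b c\<rbrakk> \<Longrightarrow> Le A a c"
  unfolding Le_def by (metis Meet_assoc)

lemma Le_antisym: "\<lbrakk>a \<in> carrier A; b \<in> carrier A; Le A a b; Le A b a\<rbrakk> \<Longrightarrow> a = b"
  unfolding Le_def by (metis Meet_commute)

lemma Meet_Le1: "\<lbrakk>a \<in> carrier A; b \<in> carrier A\<rbrakk> \<Longrightarrow> Le A (Meet A a b) a"
  unfolding Le_def by (metis Meet_assoc Meet_commute Meet_idem)

lemma Meet_Le2: "\<lbrakk>a \<in> carrier A; b \<in> carrier A\<rbrakk> \<Longrightarrow> Le A (Meet A a b) b"
  unfolding Le_def by (metis Meet_assoc Meet_idem)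

lemma Le_Meet:
  "\<lbrakk>a \<in> carrier A; b \<in> carrier A; c \<in> carrier A; Le A c a; Le A c b\<rbrakk> \<Longrightarrow> Le A c (Meet A a b)"
  unfolding Le_def by (metis Meet_assoc)

lemma Meet_mono_left:
  assumes "a \<in> carrier A" "b \<in> carrier A" "c \<in> carrier A" "Le A a b"
  shows "Le A (Meet A a c) (Meet A b c)"
proof -
  have "Le A (Meet A a c) b"
    using assms Le_trans[of "Meet A a c" a b] by (simp add: Meet_Le1 Meet_closed)
  then show ?thesis
    using assms by (simp add: Le_Meet Meet_Le2 Meet_closed)
qed

lemma Le_Join1: "\<lbrakk>a \<in> carrier A; b \<in> carrier A\<rbrakk> \<Longrightarrow> Le A a (Join A a b)"
  unfolding Le_def by (rule Meet_absorb)

lemma Le_Join2: "\<lbrakk>a \<in> carrier A; b \<in> carrier A\<rbrakk> \<Longrightarrow> Le A b (Join A a b)"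
  unfolding Le_def by (metis Meet_absorb Join_commute)

lemma Join_Le:
  "\<lbrakk>a \<in> carrier A; b \<in> carrier A; c \<in> carrier A; Le A a c; Le A b c\<rbrakk> \<Longrightarrow> Le A (Join A a b) c"
  unfolding Le_def by (metis Join_closed Meet_Join_distrib Meet_commute)

text \<open>Expresses the top through operations that Heyting homomorphisms preserve by definition;
  preservation of \<open>One\<close> will follow.\<close>

lemma Imp_Zero_Zero: "Imp A (Zero A) (Zero A) = One A"
proof -
  have "Le A (One A) (Imp A (Zero A) (Zero A))"
    using Imp_adjoint[OF Zero_closed Zero_closed One_closed] Meet_Le2[OF One_closed Zero_closed]
    by blast
  then show ?thesis
    using Le_antisym Le_One Imp_closed One_closed Zero_closed by blast
qed

text \<open>Modus ponens: the adjunction applied to the reflexive inequality at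
  \<open>Imp A a b\<close>.\<close>

lemma Meet_Imp_Le: "\<lbrakk>a \<in> carrier A; b \<in> carrier A\<rbrakk> \<Longrightarrow> Le A (Meet A (Imp A a b) a) b"
  by (simp add: Imp_adjoint Imp_closed Le_refl)

section \<open>Filters and prime filters\<close>

definition lattice_filter :: "'a set \<Rightarrow> bool" where
  "lattice_filter U \<longleftrightarrow> U \<subseteq> carrier A \<and> One A \<in> U \<and>
    (\<forall>a \<in> U. \<forall>b \<in> U. Meet A a b \<in> U) \<and>
    (\<forall>a \<in> U. \<forall>b \<in> carrier A. Le A a b \<longrightarrow> b \<in> U)"

text \<open>For a filter \<open>U\<close> and \<open>a\<close> in the carrier, this is the filter
  generated by \<open>U\<close> and \<open>a\<close>. It may be improper.\<close>

definition extend_filter :: "'a set \<Rightarrow> 'a \<Rightarrow> 'a set" where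
  "extend_filter U a = {c \<in> carrier A. \<exists>u \<in> U. Le A (Meet A u a) c}"

lemma lattice_filter_extend:
  assumes U: "lattice_filter U" and a: "a \<in> carrier A"
  shows "lattice_filter (extend_filter U a)"
  unfolding lattice_filter_def
proof (intro conjI ballI impI)
  show "extend_filter U a \<subseteq> carrier A"
    by (auto simp: extend_filter_def)
  show "One A \<in> extend_filter U a"
    using U a unfolding lattice_filter_def extend_filter_def
    by (auto intro!: bexI[of _ "One A"] Le_One Meet_closed One_closed)
next
  fix c d assume "c \<in> extend_filter U a" "d \<in> extend_filter U a"
  then obtain u v where uv: "u \<in> U" "v \<in> U" and cd: "c \<in> carrier A" "d \<in> carrier A"
    and le: "Le A (Meet A u a) c" "Le A (Meet A v a) d"
    unfolding extend_filter_def by blast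
  have car: "u \<in> carrier A" "v \<in> carrier A" and w: "Meet A u v \<in> U"
    using U uv unfolding lattice_filter_def by auto
  have uva: "Meet A (Meet A u v) a \<in> carrier A"
    using car a by (simp add: Meet_closed)
  have "Le A (Meet A (Meet A u v) a) (Meet A u a)" "Le A (Meet A (Meet A u v) a) (Meet A v a)"
    using car a by (simp_all add: Meet_mono_left Meet_Le1 Meet_Le2 Meet_closed)
  then have "Le A (Meet A (Meet A u v) a) c" "Le A (Meet A (Meet A u v) a) d"
    using le uva car cd a Le_trans[OF uva Meet_closed] by blast+
  then have "Le A (Meet A (Meet A u v) a) (Meet A c d)"
    using Le_Meet cd uva by blast
  then show "Meet A c d \<in> extend_filter U a"
    using w cd Meet_closed unfolding extend_filter_def by blast
next
  fix c d assume "c \<in> extend_filter U a" "d \<in> carrier A" "Le A c d"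
  then show "d \<in> extend_filter U a"
    using U a unfolding lattice_filter_def extend_filter_def
    by (smt (verit, best) Le_trans Meet_closed mem_Collect_eq subsetD)
qed

lemma extend_filter_superset:
  assumes U: "lattice_filter U" and a: "a \<in> carrier A"
  shows "insert a U \<subseteq> extend_filter U a"
proof -
  have "U \<subseteq> carrier A" "One A \<in> U"
    using U unfolding lattice_filter_def by auto
  then show ?thesis
    using a Meet_Le1 Meet_Le2 unfolding extend_filter_def by blast
qed

text \<open>Zorn's lemma gives a filter maximal among those that contain \<open>U\<close> and omit
  \<open>b\<close>. If it contained neither \<open>c\<close> nor \<open>d\<close>, adjoining either
  one would bring in \<open>b\<close>; by distributivity a join \<open>Join A c d\<close> in the
  filter would then force \<open>b\<close> into it. Properness of all filters involved is expressed
  by the omission of \<open>b\<close>.\<close>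

lemma prime_filter_exists:
  assumes U: "lattice_filter U" and b: "b \<in> carrier A" "b \<notin> U"
  obtains M where "lattice_filter M" "U \<subseteq> M" "b \<notin> M"
    "\<And>c d. \<lbrakk>c \<in> carrier A; d \<in> carrier A; Join A c d \<in> M\<rbrakk> \<Longrightarrow> c \<in> M \<or> d \<in> M"
proof -
  let ?\<F> = "{M. lattice_filter M \<and> U \<subseteq> M \<and> b \<notin> M}"
  have "\<exists>M\<in>?\<F>. \<forall>X\<in>?\<F>. M \<subseteq> X \<longrightarrow> X = M"
  proof (rule subset_Zorn_nonempty)
    show "?\<F> \<noteq> {}"
      using U b by blast
  next
    fix \<C> assume ne: "\<C> \<noteq> {}" and chain: "subset.chain ?\<F> \<C>"
    then have mem: "lattice_filter M" "U \<subseteq> M" "b \<notin> M" if "M \<in> \<C>" for M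
      using that unfolding subset.chain_def by blast+
    \<comment> \<open>Two members of a chain are comparable, so both elements already lie in a
      single filter of the chain.\<close>
    have Meet: "Meet A c d \<in> \<Union>\<C>" if cd: "c \<in> \<Union>\<C>" "d \<in> \<Union>\<C>" for c d
    proof -
      obtain M N where MN: "M \<in> \<C>" "c \<in> M" "N \<in> \<C>" "d \<in> N"
        using cd by blast
      then have "M \<subseteq> N \<or> N \<subseteq> M"
        using chain unfolding subset.chain_def by blast
      then obtain P where "P \<in> \<C>" "c \<in> P" "d \<in> P"
        using MN by blast
      then show ?thesis
        using mem(1) unfolding lattice_filter_def by blast
    qed
    have "lattice_filter (\<Union>\<C>)"
      using ne mem(1) Meet unfolding lattice_filter_def by blast
    then show "\<Union>\<C> \<in> ?\<F>"
      using ne mem by blast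
  qed
  then obtain M where M: "lattice_filter M" "U \<subseteq> M" "b \<notin> M"
    and max: "\<And>X. \<lbrakk>lattice_filter X; b \<notin> X; M \<subseteq> X\<rbrakk> \<Longrightarrow> X = M"
    by (smt (verit, best) mem_Collect_eq subset_trans)
  \<comment> \<open>The filter generated by \<open>M\<close> and \<open>c\<close> is strictly larger
    than \<open>M\<close>, so by maximality it cannot omit \<open>b\<close>.\<close>
  have reach: "\<exists>u\<in>M. Le A (Meet A u c) b" if "c \<in> carrier A" "c \<notin> M" for c
    using max[OF lattice_filter_extend[OF M(1) that(1)]] extend_filter_superset[OF M(1) that(1)] that
    unfolding extend_filter_def by blast
  have "c \<in> M \<or> d \<in> M" if cd: "c \<in> carrier A" "d \<in> carrier A" and J: "Join A c d \<in> M" for c d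
  proof (rule ccontr)
    assume "\<not> (c \<in> M \<or> d \<in> M)"
    then obtain u v where uv: "u \<in> M" "v \<in> M" and le: "Le A (Meet A u c) b" "Le A (Meet A v d) b"
      using reach cd by blast
    \<comment> \<open>A common witness below \<open>u\<close> and \<open>v\<close>, so that one
      element of \<open>M\<close> brings both \<open>c\<close> and \<open>d\<close> below
      \<open>b\<close>.\<close>
    define w where "w = Meet A u v"
    have car: "u \<in> carrier A" "v \<in> carrier A" "w \<in> carrier A" and wM: "w \<in> M"
      using M(1) uv Meet_closed unfolding lattice_filter_def w_def by auto
    have "Le A w u" "Le A w v"
      using car by (simp_all add: w_def Meet_Le1 Meet_Le2)
    then have "Le A (Meet A w c) (Meet A u c)" "Le A (Meet A w d) (Meet A v d)"
      using car cd by (simp_all add: Meet_mono_left)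
    then have "Le A (Meet A w c) b" "Le A (Meet A w d) b"
      using Le_trans[OF Meet_closed[OF car(3) cd(1)] Meet_closed[OF car(1) cd(1)] b(1) _ le(1)]
        Le_trans[OF Meet_closed[OF car(3) cd(2)] Meet_closed[OF car(2) cd(2)] b(1) _ le(2)] by blast+
    then have "Le A (Meet A w (Join A c d)) b"
      using car cd b by (simp add: Meet_Join_distrib Join_Le Meet_closed)
    moreover have "Meet A w (Join A c d) \<in> M"
      using M(1) J wM unfolding lattice_filter_def by blast
    ultimately show False
      using M(1,3) b unfolding lattice_filter_def by blast
  qed
  then show thesis
    using that M by blast
qed

text \<open>The characteristic function of a prime filter containing \<open>U\<close> and omitting
  \<open>b\<close> is the required homomorphism: primality handles joins, and \<open>Zero A\<close>
  is outside because it lies below the omitted \<open>b\<close>.\<close>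

lemma separating_hom_exists:
  assumes U: "lattice_filter U" and b: "b \<in> carrier A" "b \<notin> U"
  obtains h where "h \<in> bounded_lattice_hom A two" "\<And>a. a \<in> U \<Longrightarrow> h a" "\<not> h b"
proof -
  obtain M where M: "lattice_filter M" "U \<subseteq> M" "b \<notin> M"
    and prime: "\<And>c d. \<lbrakk>c \<in> carrier A; d \<in> carrier A; Join A c d \<in> M\<rbrakk> \<Longrightarrow> c \<in> M \<or> d \<in> M"
    using prime_filter_exists[OF assms] by blast
  have MC: "M \<subseteq> carrier A" and One: "One A \<in> M"
    and up: "\<And>c d. \<lbrakk>c \<in> M; d \<in> carrier A; Le A c d\<rbrakk> \<Longrightarrow> d \<in> M"
    and meet: "\<And>c d. \<lbrakk>c \<in> M; d \<in> M\<rbrakk> \<Longrightarrow> Meet A c d \<in> M"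
    using M(1) unfolding lattice_filter_def by auto
  have "Meet A c d \<in> M \<longleftrightarrow> c \<in> M \<and> d \<in> M" "Join A c d \<in> M \<longleftrightarrow> c \<in> M \<or> d \<in> M"
    if "c \<in> carrier A" "d \<in> carrier A" for c d
    using that meet up prime Meet_Le1 Meet_Le2 Le_Join1 Le_Join2 Join_closed by metis+
  moreover have "Zero A \<notin> M"
    using up M(3) b(1) Zero_Le by blast
  ultimately have "(\<lambda>a\<in>carrier A. a \<in> M) \<in> bounded_lattice_hom A two"
    using One One_closed Zero_closed
    by (auto simp: bounded_lattice_hom_def two_def Meet_closed Join_closed)
  then show thesis
    by (rule that) (use M(2,3) MC b(1) in auto)
qed

section \<open>Homomorphisms to the two-element algebra and implication\<close>

lemma bounded_lattice_hom_two_Le: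
  assumes h: "h \<in> bounded_lattice_hom A two" and "a \<in> carrier A" "b \<in> carrier A" "Le A a b" "h a"
  shows "h b"
proof -
  have "h (Meet A a b) = (h a \<and> h b)"
    using assms by (auto simp: bounded_lattice_hom_def two_def)
  then show ?thesis
    using assms by (simp add: Le_def)
qed

lemma lattice_filter_hom:
  assumes h: "h \<in> bounded_lattice_hom A two"
  shows "lattice_filter {a \<in> carrier A. h a}"
  using bounded_lattice_hom_two_Le[OF h] h One_closed Meet_closed
  by (auto simp: lattice_filter_def bounded_lattice_hom_def two_def)

text \<open>This is the implication clause of a system whose points are all homomorphisms to
  \<open>two\<close>. One direction is modus ponens under \<open>k\<close>. For the other, if
  \<open>h\<close> rejects \<open>Imp A a b\<close>, a separating homomorphism for the filter
  generated by the truth set of \<open>h\<close> and \<open>a\<close> lies above \<open>h\<close>,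
  accepts \<open>a\<close> and rejects \<open>b\<close>.\<close>

lemma bounded_lattice_hom_two_Imp:
  assumes h: "h \<in> bounded_lattice_hom A two" and a: "a \<in> carrier A" and b: "b \<in> carrier A"
  shows "h (Imp A a b) \<longleftrightarrow>
    (\<forall>k \<in> bounded_lattice_hom A two. hom_le A h k \<longrightarrow> \<not> k a \<or> k b)"
proof (intro iffI ballI impI)
  fix k assume hi: "h (Imp A a b)" and k: "k \<in> bounded_lattice_hom A two" and "hom_le A h k"
  then have "k (Imp A a b)"
    using a b Imp_closed by (auto simp: hom_le_def Le_def two_def)
  then have "k a \<longrightarrow> k (Meet A (Imp A a b) a)"
    using k a b Imp_closed by (auto simp: bounded_lattice_hom_def two_def)
  then show "\<not> k a \<or> k b"
    using bounded_lattice_hom_two_Le[OF k _ b Meet_Imp_Le[OF a b]] a b Meet_closed Imp_closed by blast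
next
  assume all: "\<forall>k \<in> bounded_lattice_hom A two. hom_le A h k \<longrightarrow> \<not> k a \<or> k b"
  let ?U = "{c \<in> carrier A. h c}"
  have U: "lattice_filter ?U"
    using lattice_filter_hom[OF h] .
  show "h (Imp A a b)"
  proof (rule ccontr)
    assume not: "\<not> h (Imp A a b)"
    \<comment> \<open>If some \<open>u\<close> accepted by \<open>h\<close> had its meet with
      \<open>a\<close> below \<open>b\<close>, then by adjunction \<open>u\<close> would lie below
      \<open>Imp A a b\<close>, and \<open>h\<close> would accept that too.\<close>
    have "b \<notin> extend_filter ?U a"
      using not bounded_lattice_hom_two_Le[OF h] Imp_adjoint[OF a b] Imp_closed[OF a b]
      unfolding extend_filter_def by blast
    then obtain k where k: "k \<in> bounded_lattice_hom A two" "\<And>c. c \<in> extend_filter ?U a \<Longrightarrow> k c" "\<not> k b"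
      using separating_hom_exists[OF lattice_filter_extend[OF U a] b] by blast
    then have "hom_le A h k" "k a"
      using extend_filter_superset[OF U a] by (auto simp: hom_le_def Le_def two_def)
    then show False
      using all k by blast
  qed
qed

text \<open>In a nontrivial algebra the least filter \<open>{One A}\<close> omits
  \<open>Zero A\<close>, so a separating homomorphism exists. This supplies the points of a nonempty
  spectrum.\<close>

lemma bounded_lattice_hom_two_nonempty:
  assumes "Zero A \<noteq> One A"
  shows "bounded_lattice_hom A two \<noteq> {}"
proof -
  have "lattice_filter {One A}"
    unfolding lattice_filter_def
    by (auto simp: One_closed Meet_idem intro: Le_antisym Le_One)
  then show ?thesis
    using separating_hom_exists[of "{One A}" "Zero A"] Zero_closed assms by blast
qed

end

section \<open>Categories of Heyting algebras and of systems\<close>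

text \<open>The top is \<open>Imp A (Zero A) (Zero A)\<close>, and both implication and bottom are
  preserved.\<close>

lemma heyting_hom_One:
  assumes "heyting_algebra A" "heyting_algebra B" "f \<in> heyting_hom A B"
  shows "f (One A) = One B"
  using assms heyting_algebra.Imp_Zero_Zero[of A] heyting_algebra.Imp_Zero_Zero[of B]
    heyting_algebra.Zero_closed[of A]
  unfolding heyting_hom_def by (metis (mono_tags, lifting) mem_Collect_eq)

lemma heyting_hom_compose:
  assumes A: "heyting_algebra A" and f: "f \<in> heyting_hom A B" and g: "g \<in> heyting_hom B C"
  shows "compose (carrier A) g f \<in> heyting_hom A C"
proof -
  interpret heyting_algebra A by fact
  have "f \<in> carrier A \<rightarrow> carrier B"
    using f by (auto simp: heyting_hom_def)
  then show ?thesis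
    using f g
    by (auto simp: heyting_hom_def compose_def Pi_iff Meet_closed Join_closed Imp_closed Zero_closed)
qed

lemma heyting_hom_id:
  assumes A: "heyting_algebra A"
  shows "(\<lambda>a\<in>carrier A. a) \<in> heyting_hom A A"
proof -
  interpret heyting_algebra A by fact
  show ?thesis
    by (auto simp: heyting_hom_def Meet_closed Join_closed Imp_closed Zero_closed)
qed

text \<open>With \<open>C\<close> taken as \<open>two\<close>, this precomposition is how a Heyting
  homomorphism acts contravariantly on points.\<close>

lemma bounded_lattice_hom_compose:
  assumes A: "heyting_algebra A" and B: "heyting_algebra B" and f: "f \<in> heyting_hom A B"
    and h: "h \<in> bounded_lattice_hom B C"
  shows "compose (carrier A) h f \<in> bounded_lattice_hom A C"
proof -
  interpret heyting_algebra A by fact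
  have "f \<in> carrier A \<rightarrow> carrier B"
    using f by (auto simp: heyting_hom_def)
  then show ?thesis
    using f h heyting_hom_One[OF A B f]
    by (auto simp: heyting_hom_def bounded_lattice_hom_def compose_def Pi_iff Meet_closed Join_closed
        One_closed Zero_closed)
qed

text \<open>The object set is left arbitrary so that all Heyting algebras and the nontrivial ones
  are treated together.\<close>

lemma category_HA:
  assumes Q: "\<And>A. A \<in> Q \<Longrightarrow> heyting_algebra A"
  shows "category (HA\<lparr>Obj := Q\<rparr>)"
proof
  fix W X Y Z :: "'a heyting" and f g h
  assume "f \<in> Hom (HA\<lparr>Obj := Q\<rparr>) W X"
  then have "f \<in> carrier W \<rightarrow> carrier X"
    by (auto simp: HA_def heyting_hom_def)
  then show "Comp (HA\<lparr>Obj := Q\<rparr>) W Y Z h (Comp (HA\<lparr>Obj := Q\<rparr>) W X Y g f) =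
    Comp (HA\<lparr>Obj := Q\<rparr>) W X Z (Comp (HA\<lparr>Obj := Q\<rparr>) X Y Z h g) f"
    by (simp add: HA_def compose_assoc)
next
  fix X Y :: "'a heyting" and f
  assume "f \<in> Hom (HA\<lparr>Obj := Q\<rparr>) X Y"
  then have "f \<in> carrier X \<rightarrow> carrier Y" "f \<in> extensional (carrier X)"
    by (simp_all add: HA_def heyting_hom_def PiE_def)
  then show "Comp (HA\<lparr>Obj := Q\<rparr>) X X Y f (Ident (HA\<lparr>Obj := Q\<rparr>) X) = f"
    "Comp (HA\<lparr>Obj := Q\<rparr>) X Y Y (Ident (HA\<lparr>Obj := Q\<rparr>) Y) f = f"
    by (simp_all add: HA_def compose_Id Id_compose)
qed (simp_all add: HA_def Q heyting_hom_id heyting_hom_compose)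

section \<open>Systems and their arrows\<close>

lemma top_system_hom_compose:
  assumes U: "heyting_algebra (algebra U)"
    and f: "(f\<^sub>1, f\<^sub>2) \<in> top_system_hom S T" and g: "(g\<^sub>1, g\<^sub>2) \<in> top_system_hom T U"
  shows "(compose (points S) g\<^sub>1 f\<^sub>1, compose (carrier (algebra U)) f\<^sub>2 g\<^sub>2) \<in> top_system_hom S U"
proof -
  have "g\<^sub>2 \<in> carrier (algebra U) \<rightarrow> carrier (algebra T)" "f\<^sub>1 \<in> points S \<rightarrow> points T"
    using f g by (auto simp: top_system_hom_def heyting_hom_def)
  then show ?thesis
    using f g heyting_hom_compose[OF U, of g\<^sub>2 "algebra T" f\<^sub>2 "algebra S"]
    by (auto simp: top_system_hom_def compose_def Pi_iff)
qed

lemma category_HI_TopSys: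
  assumes P: "\<And>S. S \<in> P \<Longrightarrow> i_topological_system_or_empty S"
  shows "category (HI_TopSys\<lparr>Obj := P\<rparr>)"
proof -
  have H: "heyting_algebra (algebra S)" if "S \<in> P" for S
    using P[OF that] by (rule i_topological_system_or_empty.heyting_algebra_algebra)
  show ?thesis
  proof
    fix S assume "S \<in> Obj (HI_TopSys\<lparr>Obj := P\<rparr>)"
    then show "Ident (HI_TopSys\<lparr>Obj := P\<rparr>) S \<in> Hom (HI_TopSys\<lparr>Obj := P\<rparr>) S S"
      using H by (auto simp: HI_TopSys_def top_system_hom_def heyting_hom_id)
  next
    fix S T U f g
    assume "U \<in> Obj (HI_TopSys\<lparr>Obj := P\<rparr>)"
      "f \<in> Hom (HI_TopSys\<lparr>Obj := P\<rparr>) S T" "g \<in> Hom (HI_TopSys\<lparr>Obj := P\<rparr>) T U"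
    then show "Comp (HI_TopSys\<lparr>Obj := P\<rparr>) S T U g f \<in> Hom (HI_TopSys\<lparr>Obj := P\<rparr>) S U"
      using top_system_hom_compose[OF H, of U "fst f" "snd f" S T "fst g" "snd g"]
      by (auto simp: HI_TopSys_def split_beta)
  next
    fix S T f assume "f \<in> Hom (HI_TopSys\<lparr>Obj := P\<rparr>) S T"
    then show "Comp (HI_TopSys\<lparr>Obj := P\<rparr>) S S T f (Ident (HI_TopSys\<lparr>Obj := P\<rparr>) S) = f"
      "Comp (HI_TopSys\<lparr>Obj := P\<rparr>) S T T (Ident (HI_TopSys\<lparr>Obj := P\<rparr>) T) f = f"
      by (auto simp: HI_TopSys_def top_system_hom_def heyting_hom_def PiE_def compose_Id Id_compose)
  next
    fix R S T U f g h
    assume f: "f \<in> Hom (HI_TopSys\<lparr>Obj := P\<rparr>) R S" and "g \<in> Hom (HI_TopSys\<lparr>Obj := P\<rparr>) S T"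
      and h: "h \<in> Hom (HI_TopSys\<lparr>Obj := P\<rparr>) T U"
    obtain f\<^sub>1 f\<^sub>2 g\<^sub>1 g\<^sub>2 h\<^sub>1 h\<^sub>2 where eq: "f = (f\<^sub>1, f\<^sub>2)" "g = (g\<^sub>1, g\<^sub>2)" "h = (h\<^sub>1, h\<^sub>2)"
      by (metis surj_pair)
    then have "f\<^sub>1 \<in> points R \<rightarrow> points S" "h\<^sub>2 \<in> carrier (algebra U) \<rightarrow> carrier (algebra T)"
      using f h by (auto simp: HI_TopSys_def top_system_hom_def heyting_hom_def)
    then show "Comp (HI_TopSys\<lparr>Obj := P\<rparr>) R T U h (Comp (HI_TopSys\<lparr>Obj := P\<rparr>) R S T g f) =
      Comp (HI_TopSys\<lparr>Obj := P\<rparr>) R S U (Comp (HI_TopSys\<lparr>Obj := P\<rparr>) S T U h g) f"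
      by (simp add: eq HI_TopSys_def compose_assoc)
  qed
qed

text \<open>Turns the satisfaction condition on an arrow, at a point \<open>x\<close> with image
  \<open>y\<close>, into an equation between homomorphisms that a bijective \<open>pstar T\<close>
  can solve for \<open>y\<close>.\<close>

lemma pstar_eq_iff:
  "pstar T y = compose (carrier (algebra T)) (pstar S x) k \<longleftrightarrow>
    (\<forall>b \<in> carrier (algebra T). sat T y b \<longleftrightarrow> sat S x (k b))"
  if "k \<in> carrier (algebra T) \<rightarrow> carrier (algebra S)"
  using that by (auto simp: pstar_def compose_def fun_eq_iff restrict_def Pi_iff)

text \<open>Injectivity of \<open>pstar T\<close> makes the point component unique, and surjectivity
  of \<open>pstar T\<close> makes it exist.\<close>

lemma bij_betw_snd_top_system_hom:
  assumes S: "heyting_algebra (algebra S)" "heyting_algebraic S"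
    and T: "heyting_algebra (algebra T)" "heyting_algebraic T"
  shows "bij_betw snd (top_system_hom S T) (heyting_hom (algebra T) (algebra S))"
proof -
  have S_hom: "pstar S x \<in> bounded_lattice_hom (algebra S) two" if "x \<in> points S" for x
    using S(2) that unfolding heyting_algebraic_def by (rule bij_betw_apply)
  have T_inj: "inj_on (pstar T) (points T)"
    and T_surj: "pstar T ` points T = bounded_lattice_hom (algebra T) two"
    using T(2) unfolding heyting_algebraic_def bij_betw_def by auto
  have k_Pi: "k \<in> carrier (algebra T) \<rightarrow> carrier (algebra S)"
    if "k \<in> heyting_hom (algebra T) (algebra S)" for k
    using that by (auto simp: heyting_hom_def)
  have "inj_on snd (top_system_hom S T)"
  proof (rule inj_onI)
    fix f g assume fg: "f \<in> top_system_hom S T" "g \<in> top_system_hom S T" "snd f = snd g"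
    obtain f\<^sub>1 g\<^sub>1 k where eq: "f = (f\<^sub>1, k)" "g = (g\<^sub>1, k)"
      using fg(3) by (metis prod.collapse)
    have "f\<^sub>1 x = g\<^sub>1 x" if x: "x \<in> points S" for x
    proof (rule inj_onD[OF T_inj])
      show "f\<^sub>1 x \<in> points T" "g\<^sub>1 x \<in> points T"
        using fg x by (auto simp: eq top_system_hom_def)
      show "pstar T (f\<^sub>1 x) = pstar T (g\<^sub>1 x)"
        using fg x by (auto simp: eq top_system_hom_def pstar_def fun_eq_iff restrict_def)
    qed
    then show "f = g"
      using fg by (auto simp: eq top_system_hom_def intro: PiE_ext)
  qed
  moreover have "snd ` top_system_hom S T = heyting_hom (algebra T) (algebra S)"
  proof
    show "snd ` top_system_hom S T \<subseteq> heyting_hom (algebra T) (algebra S)"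
      by (auto simp: top_system_hom_def)
    show "heyting_hom (algebra T) (algebra S) \<subseteq> snd ` top_system_hom S T"
    proof
      fix k assume k: "k \<in> heyting_hom (algebra T) (algebra S)"
      have "\<exists>y \<in> points T. pstar T y = compose (carrier (algebra T)) (pstar S x) k"
        if "x \<in> points S" for x
        using bounded_lattice_hom_compose[OF T(1) S(1) k S_hom[OF that]] T_surj
        by (metis imageE)
      then obtain f where f: "\<And>x. x \<in> points S \<Longrightarrow> f x \<in> points T \<and>
          pstar T (f x) = compose (carrier (algebra T)) (pstar S x) k"
        by metis
      \<comment> \<open>The chosen \<open>f\<close> is arbitrary off \<open>points S\<close>;
        restricting it yields an extensional map, as arrows require.\<close>
      have "(restrict f (points S), k) \<in> top_system_hom S T"
        using f k pstar_eq_iff[OF k_Pi[OF k]] by (auto simp: top_system_hom_def)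
      then show "k \<in> snd ` top_system_hom S T"
        by force
    qed
  qed
  ultimately show ?thesis
    by (simp add: bij_betw_def)
qed

text \<open>The map \<open>i\<close>, injective in all uses, encodes homomorphisms as points of type
  \<open>'x\<close>. The carrier condition and the existential quantifier make \<open>sat\<close>
  false off the points and the carrier, as \<open>sat_dom\<close> demands.\<close>

definition spectrum :: "(('a \<Rightarrow> bool) \<Rightarrow> 'x) \<Rightarrow> 'a heyting \<Rightarrow> ('x, 'a) top_system" where
  "spectrum i A =
    \<lparr>points = i ` bounded_lattice_hom A two,
     sat = (\<lambda>x a. a \<in> carrier A \<and> (\<exists>h \<in> bounded_lattice_hom A two. x = i h \<and> h a)),
     algebra = A\<rparr>"

lemma sat_spectrum:
  "\<lbrakk>inj i; h \<in> bounded_lattice_hom A two; a \<in> carrier A\<rbrakk> \<Longrightarrow> sat (spectrum i A) (i h) a = h a"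
  by (auto simp: spectrum_def inj_eq)

lemma pstar_spectrum:
  assumes "inj i" "h \<in> bounded_lattice_hom A two"
  shows "pstar (spectrum i A) (i h) = h"
proof -
  \<comment> \<open>Extensionality makes \<open>h\<close> agree with the restricted function
    \<open>pstar\<close> off the carrier as well.\<close>
  have "h \<in> extensional (carrier A)"
    using assms(2) by (simp add: bounded_lattice_hom_def PiE_def)
  moreover have "algebra (spectrum i A) = A"
    by (simp add: spectrum_def)
  ultimately show ?thesis
    using sat_spectrum[OF assms]
    by (auto simp: pstar_def fun_eq_iff extensional_def)
qed

lemma heyting_algebraic_spectrum:
  assumes "inj i"
  shows "heyting_algebraic (spectrum i A)"
proof -
  have "bij_betw (pstar (spectrum i A)) (i ` bounded_lattice_hom A two) (bounded_lattice_hom A two)"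
    by (rule bij_betw_byWitness[where f' = i]) (auto simp: pstar_spectrum[OF assms])
  then show ?thesis
    by (simp add: heyting_algebraic_def spectrum_def)
qed

text \<open>Since \<open>pstar\<close> decodes \<open>i h\<close> to \<open>h\<close>, the lattice
  clauses say that \<open>h\<close> is a homomorphism, and the implication clause becomes
  \<open>bounded_lattice_hom_two_Imp\<close>.\<close>

lemma i_topological_system_or_empty_spectrum:
  assumes i: "inj i" and A: "heyting_algebra A"
  shows "i_topological_system_or_empty (spectrum i A)"
proof -
  interpret heyting_algebra A by fact
  have alg: "algebra (spectrum i A) = A" and pts: "points (spectrum i A) = i ` bounded_lattice_hom A two"
    by (simp_all add: spectrum_def)
  show ?thesis
  proof (rule i_topological_system_or_empty.intro)
    show "heyting_algebra (algebra (spectrum i A))"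
      by (simp add: alg A)
    show "x \<in> points (spectrum i A) \<and> a \<in> carrier (algebra (spectrum i A))"
      if "sat (spectrum i A) x a" for x a
      using that by (auto simp: spectrum_def)
    fix x assume "x \<in> points (spectrum i A)"
    then obtain h where x: "x = i h" and h: "h \<in> bounded_lattice_hom A two"
      by (auto simp: pts)
    note h_simps = h[unfolded bounded_lattice_hom_def two_def, simplified]
    show "\<not> sat (spectrum i A) x (Zero (algebra (spectrum i A)))"
      using h_simps by (simp add: x alg sat_spectrum[OF i h] Zero_closed)
    fix a b assume "a \<in> carrier (algebra (spectrum i A))" "b \<in> carrier (algebra (spectrum i A))"
    then have ab: "a \<in> carrier A" "b \<in> carrier A"
      by (simp_all add: alg)
    show "sat (spectrum i A) x (Meet (algebra (spectrum i A)) a b) \<longleftrightarrow>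
        sat (spectrum i A) x a \<and> sat (spectrum i A) x b"
      and "sat (spectrum i A) x (Join (algebra (spectrum i A)) a b) \<longleftrightarrow>
        sat (spectrum i A) x a \<or> sat (spectrum i A) x b"
      using h_simps ab by (simp_all add: x alg sat_spectrum[OF i h] Meet_closed Join_closed)
    show "sat (spectrum i A) x (Imp (algebra (spectrum i A)) a b) \<longleftrightarrow>
      (\<forall>y \<in> points (spectrum i A).
        hom_le (algebra (spectrum i A)) (pstar (spectrum i A) x) (pstar (spectrum i A) y) \<longrightarrow>
        \<not> sat (spectrum i A) y a \<or> sat (spectrum i A) y b)"
      using h ab
      by (simp add: x alg pts sat_spectrum pstar_spectrum i Imp_closed bounded_lattice_hom_two_Imp)
  qed
qed

text \<open>Any class of systems and any class of algebras that correspond under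
  \<open>algebra\<close> and \<open>spectrum i\<close> are dual. Both dualities below are
  instances.\<close>

lemma dually_equivalent_HI_TopSys_HA:
  fixes i :: "('a \<Rightarrow> bool) \<Rightarrow> 'x" and P :: "('x, 'a) top_system set"
  assumes P: "\<And>S. S \<in> P \<Longrightarrow> i_topological_system_or_empty S \<and> heyting_algebraic S"
    and Q: "\<And>A. A \<in> Q \<Longrightarrow> heyting_algebra A"
    and algebra: "\<And>S. S \<in> P \<Longrightarrow> algebra S \<in> Q"
    and spectrum: "\<And>A. A \<in> Q \<Longrightarrow> spectrum i A \<in> P"
  shows "dually_equivalent (HI_TopSys\<lparr>Obj := P\<rparr>) (HA\<lparr>Obj := Q\<rparr>)"
  unfolding dually_equivalent_def
proof (rule equivalent_categories_if_fully_faithful_section)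
  \<comment> \<open>The algebra component of an arrow runs backwards, so taking second components is
    covariant into the opposite category.\<close>
  let ?F = "\<lparr>on_obj = algebra, on_arr = (\<lambda>S T. snd)\<rparr> ::
    (('x, 'a) top_system, ('x \<Rightarrow> 'x) \<times> ('a \<Rightarrow> 'a), 'a heyting, 'a \<Rightarrow> 'a) functor_data"
  show "category (HI_TopSys\<lparr>Obj := P\<rparr>)"
    using category_HI_TopSys P by blast
  show "category (op_category (HA\<lparr>Obj := Q\<rparr>))"
    using category_op_category category_HA Q by blast
  show "is_functor (HI_TopSys\<lparr>Obj := P\<rparr>) (op_category (HA\<lparr>Obj := Q\<rparr>)) ?F"
    by unfold_locales (auto simp: HI_TopSys_def HA_def op_category_def algebra top_system_hom_def)
  show "bij_betw (on_arr ?F S T) (Hom (HI_TopSys\<lparr>Obj := P\<rparr>) S T)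
      (Hom (op_category (HA\<lparr>Obj := Q\<rparr>)) (on_obj ?F S) (on_obj ?F T))"
    if "S \<in> Obj (HI_TopSys\<lparr>Obj := P\<rparr>)" "T \<in> Obj (HI_TopSys\<lparr>Obj := P\<rparr>)" for S T
    using that P Q algebra bij_betw_snd_top_system_hom[of S T]
    by (simp add: HI_TopSys_def HA_def op_category_def)
  show "spectrum i A \<in> Obj (HI_TopSys\<lparr>Obj := P\<rparr>)" "on_obj ?F (spectrum i A) = A"
    if "A \<in> Obj (op_category (HA\<lparr>Obj := Q\<rparr>))" for A
    using that spectrum by (simp_all add: op_category_def spectrum_def)
qed

text \<open>A point gives a homomorphism to \<open>two\<close>, whose values at \<open>Zero\<close>
  and \<open>One\<close> differ.\<close>

lemma Zero_neq_One_algebra: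
  assumes "i_topological_system S" "heyting_algebraic S"
  shows "Zero (algebra S) \<noteq> One (algebra S)"
proof -
  obtain x where "x \<in> points S"
    using i_topological_system.points_nonempty[OF assms(1)] by blast
  then have "pstar S x \<in> bounded_lattice_hom (algebra S) two"
    using assms(2) unfolding heyting_algebraic_def by (blast intro: bij_betw_apply)
  then show ?thesis
    by (auto simp: bounded_lattice_hom_def two_def)
qed

theorem theorem3:
  assumes "\<exists>i :: ('a \<Rightarrow> bool) \<Rightarrow> 'x. inj i"
  shows "dually_equivalent
           (HI_TopSys :: (('x, 'a) top_system, ('x \<Rightarrow> 'x) \<times> ('a \<Rightarrow> 'a)) category)
           (HA_nontrivial :: ('a heyting, 'a \<Rightarrow> 'a) category) \<and>
         dually_equivalent
           (HI_TopSys_or_empty :: (('x, 'a) top_system, ('x \<Rightarrow> 'x) \<times> ('a \<Rightarrow> 'a)) category)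
           (HA :: ('a heyting, 'a \<Rightarrow> 'a) category)"
proof
  obtain i :: "('a \<Rightarrow> bool) \<Rightarrow> 'x" where i: "inj i"
    using assms by blast
  note algebra = i_topological_system_or_empty.heyting_algebra_algebra
  have or_empty: "i_topological_system_or_empty S" if "i_topological_system S" for S :: "('x, 'a) top_system"
    using that by (simp add: i_topological_system_def)
  let ?P = "{S :: ('x, 'a) top_system. i_topological_system S \<and> heyting_algebraic S}"
  have "dually_equivalent (HI_TopSys\<lparr>Obj := ?P\<rparr>)
      (HA\<lparr>Obj := {A :: 'a heyting. heyting_algebra A \<and> Zero A \<noteq> One A}\<rparr>)"
  proof (rule dually_equivalent_HI_TopSys_HA[where i = i])
    fix A :: "'a heyting" assume "A \<in> {A. heyting_algebra A \<and> Zero A \<noteq> One A}"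
    then have A: "heyting_algebra A" "Zero A \<noteq> One A"
      by auto
    \<comment> \<open>Nontriviality of the algebra enters here, matching the nonemptiness of point
      sets.\<close>
    have "points (spectrum i A) \<noteq> {}"
      using heyting_algebra.bounded_lattice_hom_two_nonempty[OF A] by (simp add: spectrum_def)
    then show "spectrum i A \<in> ?P"
      using i_topological_system_or_empty_spectrum[OF i A(1)] heyting_algebraic_spectrum[OF i]
      by (simp add: i_topological_system_def i_topological_system_axioms_def)
  qed (auto simp: or_empty algebra Zero_neq_One_algebra)
  moreover have "HI_TopSys\<lparr>Obj := ?P\<rparr> = HI_TopSys"
    by (simp add: HI_TopSys_def)
  ultimately show "dually_equivalent
      (HI_TopSys :: (('x, 'a) top_system, ('x \<Rightarrow> 'x) \<times> ('a \<Rightarrow> 'a)) category)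
      (HA_nontrivial :: ('a heyting, 'a \<Rightarrow> 'a) category)"
    by (simp add: HA_nontrivial_def)
  have "dually_equivalent
      (HI_TopSys\<lparr>Obj := {S :: ('x, 'a) top_system. i_topological_system_or_empty S \<and> heyting_algebraic S}\<rparr>)
      (HA\<lparr>Obj := {A :: 'a heyting. heyting_algebra A}\<rparr>)"
    by (rule dually_equivalent_HI_TopSys_HA[where i = i])
      (auto simp: algebra i_topological_system_or_empty_spectrum[OF i] heyting_algebraic_spectrum[OF i])
  moreover have "HA\<lparr>Obj := {A :: 'a heyting. heyting_algebra A}\<rparr> = HA"
    by (simp add: HA_def)
  ultimately show "dually_equivalent
      (HI_TopSys_or_empty :: (('x, 'a) top_system, ('x \<Rightarrow> 'x) \<times> ('a \<Rightarrow> 'a)) category)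
      (HA :: ('a heyting, 'a \<Rightarrow> 'a) category)"
    by (simp add: HI_TopSys_or_empty_def)
qed

end
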